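(* Let $P$ be a finite poset and $j\in\{1,2\}$. Then \[ M_j(P,n)\le \frac{1}{t_j(P)}\binom{n}{\lfloor n/2\rfloor}\bigl(1+O(n^{-1})\bigr) \] as $n\to\infty$ (the implied constant may depend on $P$).
   Context: $B_n$ denotes the poset of all subsets of $[n]$ ordered by inclusion. For a finite poset $(P,<_p)$, an embedding $f:P\to B_n$ is an injective map with $f(a)\subset f(b)$ whenever $a<_p b$; an induced embedding is an injective map with $f(a)\subset f(b)$ if and only if $a<_p b$. Two sets $X,Y$ of subsets of $[n]$ are incomparable if there are no $x\in X$, $y\in Y$ with $x\subseteq y$ or $y\subseteq x$; a family of sets of subsets is incomparable if its members are pairwise incomparable. $M_1(P,n)$ (resp. $M_2(P,n)$) is the largest $M$ such that there exist embeddings (resp. induced embeddings) $f_1,\dots,f_M:P\to B_n$ with $\{\mathrm{Im}(f_i)\}_{i=1}^M$ an incomparable family. For $F\subseteq B_n$, $\mathrm{conv}(F)=\{b\in B_n:\exists a,c\in F,\ a\subseteq b\subseteq c\}$. $t_1(P)$ (resp. $t_2(P)$) is the minimum of $|\mathrm{conv}(\mathrm{Im}(f))|$ over all $n$ and all embeddings (resp. induced embeddings) $f:P\to B_n$. *)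

theory Defs
  imports "HOL-Library.Landau_Symbols" "HOL-Library.FuncSet"
begin

definition boolean_lattice :: "nat \<Rightarrow> nat set set" where
  "boolean_lattice n = Pow {1..n}"

text \<open>A poset is given by a carrier set \<open>P\<close> and its strict order \<open>lt\<close>,
  of which only the restriction to \<open>P\<close> matters.\<close>

definition finite_poset :: "'a set \<Rightarrow> ('a \<Rightarrow> 'a \<Rightarrow> bool) \<Rightarrow> bool" where
  "finite_poset P lt \<longleftrightarrow> finite P \<and> irreflp_on P lt \<and> transp_on P lt"

definition embedding :: "'a set \<Rightarrow> ('a \<Rightarrow> 'a \<Rightarrow> bool) \<Rightarrow> nat \<Rightarrow> ('a \<Rightarrow> nat set) \<Rightarrow> bool" where
  "embedding P lt n f \<longleftrightarrow>
     f \<in> P \<rightarrow> boolean_lattice n \<and> inj_on f P \<and>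
     (\<forall>a\<in>P. \<forall>b\<in>P. lt a b \<longrightarrow> f a \<subset> f b)"

definition induced_embedding :: "'a set \<Rightarrow> ('a \<Rightarrow> 'a \<Rightarrow> bool) \<Rightarrow> nat \<Rightarrow> ('a \<Rightarrow> nat set) \<Rightarrow> bool" where
  "induced_embedding P lt n f \<longleftrightarrow>
     f \<in> P \<rightarrow> boolean_lattice n \<and> inj_on f P \<and>
     (\<forall>a\<in>P. \<forall>b\<in>P. f a \<subset> f b \<longleftrightarrow> lt a b)"

text \<open>The index \<open>j\<close> selects the kind of embedding; it is only meant to range over \<open>{1, 2}\<close>.\<close>

definition embedding_kind ::
    "nat \<Rightarrow> 'a set \<Rightarrow> ('a \<Rightarrow> 'a \<Rightarrow> bool) \<Rightarrow> nat \<Rightarrow> ('a \<Rightarrow> nat set) \<Rightarrow> bool" where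
  "embedding_kind j P lt n f \<longleftrightarrow>
     (if j = 1 then embedding P lt n f else induced_embedding P lt n f)"

definition incomparable :: "nat set set \<Rightarrow> nat set set \<Rightarrow> bool" where
  "incomparable X Y \<longleftrightarrow> \<not> (\<exists>x\<in>X. \<exists>y\<in>Y. x \<subseteq> y \<or> y \<subseteq> x)"

text \<open>The family of images is an indexed one: images with different indices have to be
  incomparable, and hence disjoint.\<close>

definition packable ::
    "nat \<Rightarrow> 'a set \<Rightarrow> ('a \<Rightarrow> 'a \<Rightarrow> bool) \<Rightarrow> nat \<Rightarrow> nat \<Rightarrow> bool" where
  "packable j P lt n m \<longleftrightarrow>
     (\<exists>f :: nat \<Rightarrow> 'a \<Rightarrow> nat set.
        (\<forall>i\<in>{1..m}. embedding_kind j P lt n (f i)) \<and>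
        pairwise (\<lambda>i k. incomparable (f i ` P) (f k ` P)) {1..m})"

definition M_num :: "nat \<Rightarrow> 'a set \<Rightarrow> ('a \<Rightarrow> 'a \<Rightarrow> bool) \<Rightarrow> nat \<Rightarrow> nat" where
  "M_num j P lt n = Max {m. packable j P lt n m}"

definition conv :: "nat \<Rightarrow> nat set set \<Rightarrow> nat set set" where
  "conv n F = {b \<in> boolean_lattice n. \<exists>a\<in>F. \<exists>c\<in>F. a \<subseteq> b \<and> b \<subseteq> c}"

definition t_num :: "nat \<Rightarrow> 'a set \<Rightarrow> ('a \<Rightarrow> 'a \<Rightarrow> bool) \<Rightarrow> nat" where
  "t_num j P lt = (LEAST k. \<exists>n f. embedding_kind j P lt n f \<and> k = card (conv n (f ` P)))"

text \<open>The maximum and the minimum above are attained. For the maximum, \<open>P\<close> has to be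
  nonempty: if \<open>P\<close> is empty, every \<open>m\<close> is packable.\<close>

lemma packable_0: "packable j P lt n 0"
  by (simp add: packable_def)

lemma finite_packable:
  fixes P :: "'a set"
  assumes "P \<noteq> {}"
  shows "finite {m. packable j P lt n m}"
proof (rule finite_subset)
  show "{m. packable j P lt n m} \<subseteq> {..card (boolean_lattice n)}"
  proof
    fix m assume "m \<in> {m. packable j P lt n m}"
    then have "packable j P lt n m" by simp
    then obtain f :: "nat \<Rightarrow> 'a \<Rightarrow> nat set"
      where f: "\<And>i. i \<in> {1..m} \<Longrightarrow> embedding_kind j P lt n (f i)"
        and inc: "pairwise (\<lambda>i k. incomparable (f i ` P) (f k ` P)) {1..m}"
      unfolding packable_def by blast
    obtain p where p: "p \<in> P" using assms by blast
    have "inj_on (\<lambda>i. f i p) {1..m}"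
    proof (rule inj_onI, rule ccontr)
      fix i k assume "i \<in> {1..m}" "k \<in> {1..m}" "f i p = f k p" "i \<noteq> k"
      with inc p show False unfolding pairwise_def incomparable_def by blast
    qed
    moreover have "(\<lambda>i. f i p) ` {1..m} \<subseteq> boolean_lattice n"
    proof clarify
      fix i assume "i \<in> {1..m}"
      then have "f i \<in> P \<rightarrow> boolean_lattice n"
        using f[of i] by (simp add: embedding_kind_def embedding_def induced_embedding_def
            split: if_splits)
      then show "f i p \<in> boolean_lattice n" using p by blast
    qed
    moreover have "finite (boolean_lattice n)" by (simp add: boolean_lattice_def)
    ultimately have "card {1..m} \<le> card (boolean_lattice n)" by (rule card_inj_on_le)
    then show "m \<in> {..card (boolean_lattice n)}" by simp
  qed
qed simp

lemma embedding_kind_exists: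
  assumes "finite_poset P lt"
  shows "\<exists>n f. embedding_kind j P lt n f"
proof -
  from assms have fin: "finite P" and irr: "irreflp_on P lt" and tr: "transp_on P lt"
    by (auto simp: finite_poset_def)
  obtain g where g: "bij_betw g P {1..card P}"
    using fin by (metis finite_same_card_bij finite_atLeastAtMost card_atLeastAtMost diff_Suc_1)
  define D where "D a = {b \<in> P. b = a \<or> lt b a}" for a
  define f where "f a = g ` D a" for a
  have D: "D a \<subseteq> P" for a by (auto simp: D_def)
  have inj: "inj_on g P" and img: "g ` P = {1..card P}" using g by (auto simp: bij_betw_def)
  have sub: "f a \<subseteq> f b \<longleftrightarrow> a = b \<or> lt a b" if "a \<in> P" "b \<in> P" for a b
  proof -
    have "f a \<subseteq> f b \<longleftrightarrow> D a \<subseteq> D b"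
      unfolding f_def using inj_on_image_mem_iff[OF inj] D by blast
    also have "\<dots> \<longleftrightarrow> a = b \<or> lt a b"
      using that tr by (auto simp: D_def dest: transp_onD)
    finally show ?thesis .
  qed
  have asym: "\<not> lt b a" if "a \<in> P" "b \<in> P" "lt a b" for a b
    using that irr tr by (meson irreflp_onD transp_onD)
  have "f \<in> P \<rightarrow> boolean_lattice (card P)"
    using D img unfolding f_def boolean_lattice_def by blast
  moreover have "inj_on f P"
    by (rule inj_onI) (metis asym sub subset_refl)
  moreover have "\<forall>a\<in>P. \<forall>b\<in>P. f a \<subset> f b \<longleftrightarrow> lt a b"
    using sub asym irr by (metis irreflp_onD psubset_eq subset_antisym subset_refl)
  ultimately have "embedding_kind j P lt (card P) f"
    by (auto simp: embedding_kind_def embedding_def induced_embedding_def)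
  then show ?thesis by blast
qed

lemma t_num_attained:
  assumes "finite_poset P lt"
  shows "\<exists>n f. embedding_kind j P lt n f \<and> t_num j P lt = card (conv n (f ` P))"
  unfolding t_num_def by (rule LeastI_ex) (use embedding_kind_exists[OF assms] in blast)

end

theory Submission
  imports Defs "HOL-Combinatorics.Multiset_Permutations"
begin

text \<open>Convex hulls of pairwise incomparable images are pairwise incomparable, and each has at least
  \<open>t\<close> members. A uniformly random maximal chain of \<open>B\<^sub>n\<close> passes through \<open>Y\<close> with probability
  \<open>1 / (n choose |Y|)\<close>, and, given this, through a fixed nonempty \<open>X \<subset> Y\<close> with probability at most
  \<open>1 / |Y|\<close>. Hence, if all members of a hull have size at least \<open>n / 4\<close>, the chain meets \<open>t\<close> chosen
  members with probability at least \<open>t (1 - 4 t / n) / (n choose (n div 2))\<close>; if the hull has a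
  smaller member, this member alone is hit with probability at least \<open>t / (n choose (n div 2))\<close>.
  No chain meets two of the hulls, so these probabilities add up to at most 1.\<close>

section \<open>Binomial coefficients\<close>

text \<open>Pascal's rule: below the top index, one summand is large by induction and the other is
  at least 1. This later bounds the conditional probability of hitting a nonempty proper
  subset.\<close>

lemma binomial_ge_upper:
  assumes "0 < k" "k < n"
  shows "n \<le> n choose k"
  using assms
proof (induction n arbitrary: k)
  case (Suc n)
  then obtain l where k: "k = Suc l" by (cases k) auto
  show ?case
  proof (cases "k < n")
    case True
    then have "n \<le> n choose k" using Suc by simp
    moreover have "1 \<le> n choose l" using True k by (simp add: Suc_le_eq)
    ultimately show ?thesis unfolding k binomial_Suc_Suc by linarith
  next
    case False
    then have "k = n" using Suc.prems by simp
    then show ?thesis by simp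
  qed
qed simp

text \<open>The ratio of consecutive binomials, \<open>(n - i) / (i + 1)\<close>, is at least 2 as
  long as \<open>3 * (i + 1) \<le> n\<close>.\<close>

lemma power2_times_binomial_le:
  fixes n k r :: nat
  assumes "3 * (k + r) \<le> n"
  shows "2 ^ r * (n choose k) \<le> n choose (k + r)"
  using assms
proof (induction r)
  case (Suc r)
  have "Suc (k + r) * (n choose Suc (k + r)) = (n - (k + r)) * (n choose (k + r))"
    by (metis binomial_absorb_comp binomial_absorption)
  moreover have "Suc (k + r) * 2 \<le> n - (k + r)" using Suc.prems by simp
  ultimately have "Suc (k + r) * (2 * (n choose (k + r))) \<le> Suc (k + r) * (n choose Suc (k + r))"
    by (metis mult.assoc mult_le_mono1)
  then have "2 * (n choose (k + r)) \<le> n choose Suc (k + r)"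
    by (rule Suc_mult_le_cancel1[THEN iffD1])
  moreover have "2 ^ r * (n choose k) \<le> n choose (k + r)" using Suc by simp
  ultimately show ?case by simp
qed simp

section \<open>Maximal chains\<close>

text \<open>A maximal chain of \<open>Pow A\<close> is encoded by an enumeration of \<open>A\<close>: its members are the sets of
  entries of the prefixes of the list.\<close>

definition chains_through :: "'a set \<Rightarrow> 'a set \<Rightarrow> 'a list set" where
  "chains_through A X = {xs \<in> permutations_of_set A. set (take (card X) xs) = X}"

lemma chains_through_comparable:
  assumes "xs \<in> chains_through A X" "xs \<in> chains_through A Y"
  shows "X \<subseteq> Y \<or> Y \<subseteq> X"
proof -
  have "X = set (take (card X) xs)" "Y = set (take (card Y) xs)"
    using assms by (auto simp: chains_through_def)
  then show ?thesis by (metis nle_le set_take_subset_set_take)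
qed

lemma finite_chains_through [simp]: "finite (chains_through A X)"
  by (simp add: chains_through_def)

text \<open>Cutting the list at position \<open>card X\<close> separates an enumeration of
  \<open>X\<close> from one of \<open>A - X\<close>, so counting chains becomes counting
  pairs.\<close>

lemma chains_through_eq_append:
  assumes "finite A" "X \<subseteq> A"
  shows "chains_through A X
    = (\<lambda>(ys, zs). ys @ zs) ` (permutations_of_set X \<times> permutations_of_set (A - X))"
proof (intro equalityI subsetI)
  fix xs assume "xs \<in> chains_through A X"
  then have xs: "set xs = A" "distinct xs" "set (take (card X) xs) = X"
    by (auto simp: chains_through_def permutations_of_set_def)
  have "set (drop (card X) xs) = A - X"
    using xs set_take_disj_set_drop_if_distinct[OF xs(2), of "card X" "card X"]
    by (metis Diff_cancel Diff_triv Un_Diff append_take_drop_id inf_commute le_refl set_append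
        sup_bot_left)
  then have "(take (card X) xs, drop (card X) xs)
      \<in> permutations_of_set X \<times> permutations_of_set (A - X)"
    using xs by (simp add: permutations_of_set_def)
  then show "xs \<in> (\<lambda>(ys, zs). ys @ zs) ` (permutations_of_set X \<times> permutations_of_set (A - X))"
    by (rule rev_image_eqI) simp
next
  fix xs
  assume "xs \<in> (\<lambda>(ys, zs). ys @ zs) ` (permutations_of_set X \<times> permutations_of_set (A - X))"
  then obtain ys zs where "xs = ys @ zs" "ys \<in> permutations_of_set X"
    "zs \<in> permutations_of_set (A - X)" by auto
  moreover from this have "length ys = card X"
    by (simp add: length_finite_permutations_of_set)
  ultimately show "xs \<in> chains_through A X"
    using assms by (auto simp: chains_through_def permutations_of_set_def)
qed

lemma inj_on_append_permutations:
  "inj_on (\<lambda>(ys, zs). ys @ zs) (permutations_of_set X \<times> T)"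
proof (rule inj_onI, clarify)
  fix ys zs ys' zs'
  assume *: "ys \<in> permutations_of_set X" "ys' \<in> permutations_of_set X" "ys @ zs = ys' @ zs'"
  then have "length ys = length ys'" by (simp add: length_finite_permutations_of_set)
  then show "ys = ys' \<and> zs = zs'" using *(3) by simp
qed

lemma card_chains_through:
  assumes "finite A" "X \<subseteq> A"
  shows "card (chains_through A X) = fact (card X) * fact (card A - card X)"
  using assms finite_subset[OF assms(2,1)]
  by (simp add: chains_through_eq_append card_image inj_on_append_permutations
      card_cartesian_product card_Diff_subset)

text \<open>Here the cut is at \<open>card Y\<close>; the prefix of length \<open>card X\<close>
  lies within the first part, so only that part is constrained by \<open>X\<close>.\<close>

lemma chains_through_Int_eq_append:
  assumes "finite A" "X \<subseteq> Y" "Y \<subseteq> A"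
  shows "chains_through A X \<inter> chains_through A Y
    = (\<lambda>(ys, zs). ys @ zs) ` (chains_through Y X \<times> permutations_of_set (A - Y))"
proof -
  have "finite Y" using assms finite_subset by blast
  then have le: "card X \<le> card Y" using assms(2) by (rule card_mono)
  have iff: "ys @ zs \<in> chains_through A X \<longleftrightarrow> ys \<in> chains_through Y X"
    if "ys \<in> permutations_of_set Y" "zs \<in> permutations_of_set (A - Y)" for ys zs
  proof -
    have "length ys = card Y" using that by (simp add: length_finite_permutations_of_set)
    then show ?thesis using that le assms
      by (auto simp: chains_through_def permutations_of_set_def)
  qed
  have "chains_through Y X \<subseteq> permutations_of_set Y" by (auto simp: chains_through_def)
  then show ?thesis
    unfolding chains_through_eq_append[OF assms(1,3)] using iff by fastforce
qed

lemma card_chains_through_Int: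
  assumes "finite A" "X \<subseteq> Y" "Y \<subseteq> A"
  shows "card (chains_through A X \<inter> chains_through A Y)
    = fact (card X) * fact (card Y - card X) * fact (card A - card Y)"
proof -
  have fin: "finite Y" using assms finite_subset by blast
  have "chains_through Y X \<subseteq> permutations_of_set Y" by (auto simp: chains_through_def)
  then have "inj_on (\<lambda>(ys, zs). ys @ zs) (chains_through Y X \<times> permutations_of_set (A - Y))"
    by (intro inj_on_subset[OF inj_on_append_permutations]) auto
  then show ?thesis
    using assms fin by (simp add: chains_through_Int_eq_append card_image card_cartesian_product
      card_chains_through card_Diff_subset)
qed

text \<open>Given \<open>Y\<close>, the chain hits \<open>X\<close> with probability exactly 1 /
  (\<open>card Y choose card X\<close>). For empty \<open>X\<close> this would be 1, which is why
  that case is excluded.\<close>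

lemma card_chains_through_Int_le:
  assumes "finite A" "X \<subset> Y" "Y \<subseteq> A" "X \<noteq> {}"
  shows "card (chains_through A X \<inter> chains_through A Y) * card Y \<le> card (chains_through A Y)"
proof -
  have fin: "finite Y" using assms finite_subset by blast
  then have lt: "card X < card Y" using assms(2) by (rule psubset_card_mono)
  have "finite X" using fin assms(2) by (meson finite_subset psubset_imp_subset)
  then have "0 < card X" using assms(4) by (simp add: card_gt_0_iff)
  then have "card Y \<le> card Y choose card X" using lt by (rule binomial_ge_upper)
  then have "fact (card X) * fact (card Y - card X) * card Y
      \<le> fact (card X) * fact (card Y - card X) * (card Y choose card X)"
    by (rule mult_le_mono2)
  also have "\<dots> = fact (card Y)" using lt by (intro binomial_fact_lemma) simp
  finally show ?thesis
    using assms by (simp add: card_chains_through card_chains_through_Int mult.commute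
        mult.left_commute)
qed

text \<open>An LYM inequality for families that are not antichains. The proof sorts the chains that meet
  \<open>S\<close> by their smallest member in \<open>S\<close>.\<close>

lemma lym_with_subsets:
  assumes A: "finite A" and S: "S \<subseteq> Pow A"
    and ne: "\<And>X Y. X \<in> S \<Longrightarrow> Y \<in> S \<Longrightarrow> X \<subset> Y \<Longrightarrow> X \<noteq> {}"
  shows "(\<Sum>Y\<in>S. (1 - real (card {X \<in> S. X \<subset> Y}) / real (card Y))
      / real (card A choose card Y)) \<le> 1"
proof -
  have finS: "finite S" using A S by (meson finite_Pow_iff finite_subset)
  define L where "L = chains_through A"
  \<comment> \<open>Intersecting with \<open>L Y\<close> does not change the difference, but makes
    the removed set a subset of \<open>L Y\<close>, so that cardinalities subtract.\<close>
  define E where "E Y = L Y - (\<Union>X\<in>{X \<in> S. X \<subset> Y}. L X \<inter> L Y)" for Y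
  let ?n = "card A"
  have fin: "finite (L Y)" for Y by (simp add: L_def)
  \<comment> \<open>Two sets on one chain are comparable, and the chain was removed for the larger
    of them.\<close>
  have disj: "E X \<inter> E Y = {}" if "X \<in> S" "Y \<in> S" "X \<noteq> Y" for X Y
    using that chains_through_comparable[of _ A X Y] unfolding E_def L_def by blast
  have card_E: "(1 - real (card {X \<in> S. X \<subset> Y}) / real (card Y)) / real (?n choose card Y) * fact ?n
      \<le> real (card (E Y))" if Y: "Y \<in> S" for Y
  proof -
    let ?D = "{X \<in> S. X \<subset> Y}"
    have YA: "Y \<subseteq> A" using S Y by blast
    then have le: "card Y \<le> ?n" using A by (simp add: card_mono)
    have finY: "finite Y" using YA A by (rule finite_subset)
    have bound: "real (card (L X \<inter> L Y)) \<le> real (card (L Y)) / real (card Y)" if "X \<in> ?D" for X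
    proof -
      have X: "X \<in> S" "X \<subset> Y" using that by auto
      have "card (L X \<inter> L Y) * card Y \<le> card (L Y)"
        unfolding L_def using card_chains_through_Int_le[OF A X(2) YA ne[OF X(1) Y X(2)]] .
      moreover have "0 < card Y" using X finY by (auto simp: card_gt_0_iff)
      ultimately show ?thesis
        by (simp add: pos_le_divide_eq flip: of_nat_mult)
    qed
    have "real (card (\<Union>X\<in>?D. L X \<inter> L Y)) \<le> (\<Sum>X\<in>?D. real (card (L X \<inter> L Y)))"
      using card_UN_le[of ?D "\<lambda>X. L X \<inter> L Y"] finS by (simp flip: of_nat_sum)
    also have "\<dots> \<le> real (card ?D) * (real (card (L Y)) / real (card Y))"
      by (rule sum_bounded_above) (rule bound)
    finally have *: "real (card (\<Union>X\<in>?D. L X \<inter> L Y))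
        \<le> real (card ?D) * (real (card (L Y)) / real (card Y))" .
    have "card (E Y) = card (L Y) - card (\<Union>X\<in>?D. L X \<inter> L Y)"
      unfolding E_def using fin finS by (intro card_Diff_subset) auto
    then have "real (card (E Y)) \<ge> real (card (L Y)) - real (card (\<Union>X\<in>?D. L X \<inter> L Y))"
      by simp
    with * have "real (card (L Y)) * (1 - real (card ?D) / real (card Y)) \<le> real (card (E Y))"
      by (simp add: algebra_simps)
    moreover have "real (card (L Y)) = fact ?n / real (?n choose card Y)"
      using A YA le by (simp add: L_def card_chains_through binomial_fact)
    ultimately show ?thesis by (simp add: mult.commute)
  qed
  have "(\<Sum>Y\<in>S. (1 - real (card {X \<in> S. X \<subset> Y}) / real (card Y)) / real (?n choose card Y))
      * fact ?n \<le> (\<Sum>Y\<in>S. real (card (E Y)))"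
    unfolding sum_distrib_right by (rule sum_mono) (rule card_E)
  also have "\<dots> = real (card (\<Union>Y\<in>S. E Y))"
    using finS fin disj by (subst card_UN_disjoint) (auto simp: E_def)
  also have "\<dots> \<le> real (card (permutations_of_set A))"
    using A by (intro of_nat_mono card_mono) (auto simp: E_def L_def chains_through_def)
  also have "\<dots> = fact ?n" using A by simp
  finally show ?thesis by simp
qed

section \<open>Packings of hulls\<close>

text \<open>If \<open>x \<subseteq> y\<close>, then a lower witness of \<open>x\<close> lies below
  an upper witness of \<open>y\<close>, contradicting incomparability of the original
  families.\<close>

lemma incomparable_conv:
  assumes "incomparable X Y"
  shows "incomparable (conv n X) (conv n Y)"
  unfolding incomparable_def
proof (clarify, elim disjE)
  fix x y
  assume "x \<in> conv n X" "y \<in> conv n Y"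
  then obtain a c a' c' where *: "a \<in> X" "c \<in> X" "a \<subseteq> x" "x \<subseteq> c"
    "a' \<in> Y" "c' \<in> Y" "a' \<subseteq> y" "y \<subseteq> c'"
    by (auto simp: conv_def)
  show False if "x \<subseteq> y"
  proof -
    have "a \<subseteq> c'" using * that by simp
    then show False using assms * by (auto simp: incomparable_def)
  qed
  show False if "y \<subseteq> x"
  proof -
    have "a' \<subseteq> c" using * that by simp
    then show False using assms * by (auto simp: incomparable_def)
  qed
qed

lemma subset_conv:
  assumes "F \<subseteq> boolean_lattice n"
  shows "F \<subseteq> conv n F"
  using assms by (auto simp: conv_def)

lemma embedding_kind_image_subset:
  assumes "embedding_kind j P lt n f"
  shows "f ` P \<subseteq> boolean_lattice n"
  using assms
  by (auto simp: embedding_kind_def embedding_def induced_embedding_def split: if_splits)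

lemma t_num_le_card_conv:
  assumes "embedding_kind j P lt n f"
  shows "t_num j P lt \<le> card (conv n (f ` P))"
  unfolding t_num_def by (rule Least_le) (use assms in blast)

lemma finite_conv: "finite (conv n F)"
  by (simp add: conv_def boolean_lattice_def)

lemma t_num_pos:
  assumes "finite_poset P lt" "P \<noteq> {}"
  shows "0 < t_num j P lt"
proof -
  obtain n f where f: "embedding_kind j P lt n f" "t_num j P lt = card (conv n (f ` P))"
    using t_num_attained[OF assms(1)] by blast
  have "conv n (f ` P) \<noteq> {}"
    using subset_conv[OF embedding_kind_image_subset[OF f(1)]] assms(2) by blast
  then show ?thesis using f(2) by (simp add: card_gt_0_iff finite_conv)
qed

text \<open>Only the sizes and the incomparability of the hulls matter. The LYM inequality is
  applied to a selection from each hull.\<close>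

lemma packing_bound:
  fixes t n m :: nat and C :: "nat \<Rightarrow> nat set set"
  assumes t: "0 < t" and n: "12 * t \<le> n"
    and C: "\<And>i. i \<in> {1..m} \<Longrightarrow> C i \<subseteq> Pow {1..n}"
    and card_C: "\<And>i. i \<in> {1..m} \<Longrightarrow> t \<le> card (C i)"
    and inc: "pairwise (\<lambda>i k. incomparable (C i) (C k)) {1..m}"
  shows "real m * (real t * (1 - 4 * real t / real n)) \<le> real (n choose (n div 2))"
proof -
  \<comment> \<open>A set smaller than \<open>n / 4\<close> is selected alone, since its weight
    suffices. Otherwise exactly \<open>t\<close> sets are kept, which bounds the number of selected
    sets below any one of them.\<close>
  have "\<exists>S. \<forall>i\<in>{1..m}. S i \<subseteq> C i \<and>
      ((\<exists>X. S i = {X} \<and> 4 * card X < n) \<or> (card (S i) = t \<and> (\<forall>X\<in>S i. n \<le> 4 * card X)))"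
  proof (intro bchoice ballI)
    fix i assume i: "i \<in> {1..m}"
    show "\<exists>T. T \<subseteq> C i \<and>
      ((\<exists>X. T = {X} \<and> 4 * card X < n) \<or> (card T = t \<and> (\<forall>X\<in>T. n \<le> 4 * card X)))"
    proof (cases "\<exists>X\<in>C i. 4 * card X < n")
      case True
      then show ?thesis by blast
    next
      case False
      obtain T where "T \<subseteq> C i" "card T = t"
        using obtain_subset_with_card_n[OF card_C[OF i]] by blast
      moreover from this have "\<forall>X\<in>T. n \<le> 4 * card X" using False by (meson not_le subsetD)
      ultimately show ?thesis by (intro exI[of _ T] conjI disjI2)
    qed
  qed
  then obtain S where *: "\<forall>i\<in>{1..m}. S i \<subseteq> C i \<and>
      ((\<exists>X. S i = {X} \<and> 4 * card X < n) \<or> (card (S i) = t \<and> (\<forall>X\<in>S i. n \<le> 4 * card X)))" ..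
  then have SC: "\<And>i. i \<in> {1..m} \<Longrightarrow> S i \<subseteq> C i"
    and S: "\<And>i. i \<in> {1..m} \<Longrightarrow> (\<exists>X. S i = {X} \<and> 4 * card X < n)
      \<or> (card (S i) = t \<and> (\<forall>X\<in>S i. n \<le> 4 * card X))" by simp_all
  define U where "U = (\<Union>i\<in>{1..m}. S i)"
  have same: "i = k" if "i \<in> {1..m}" "k \<in> {1..m}" "X \<in> S i" "Y \<in> S k" "X \<subseteq> Y" for i k X Y
    using that SC inc unfolding pairwise_def incomparable_def by blast
  have finS: "finite (S i)" if "i \<in> {1..m}" for i
    using SC[OF that] C[OF that] by (meson finite_Pow_iff finite_atLeastAtMost finite_subset)
  have below: "{X \<in> U. X \<subset> Y} = {X \<in> S i. X \<subset> Y}" if "i \<in> {1..m}" "Y \<in> S i" for i Y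
    using that same unfolding U_def by blast
  \<comment> \<open>Two nested selected sets come from one selection, which is then not a singleton;
    so both have size at least \<open>n / 4\<close>, and \<open>n\<close> is positive.\<close>
  have ne: "X \<noteq> {}" if XY: "X \<in> U" "Y \<in> U" "X \<subset> Y" for X Y
  proof -
    obtain i where i: "i \<in> {1..m}" "Y \<in> S i" using XY unfolding U_def by blast
    then have X: "X \<in> S i" using below[OF i] XY by blast
    then have "n \<le> 4 * card X" using S[OF i(1)] XY(3) i(2) by auto
    then show ?thesis using t n by auto
  qed
  define w where "w Y = (1 - real (card {X \<in> U. X \<subset> Y}) / real (card Y)) / real (n choose card Y)"
    for Y
  define N where "N = n choose (n div 2)"
  have N: "0 < N" by (simp add: N_def)
  have max: "n choose k \<le> N" for k unfolding N_def by (rule binomial_maximum)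
  have part: "real t * (1 - 4 * real t / real n) / real N \<le> (\<Sum>Y\<in>S i. w Y)"
    if i: "i \<in> {1..m}" for i
    using S[OF i]
  proof
    assume "\<exists>X. S i = {X} \<and> 4 * card X < n"
    then obtain X where X: "S i = {X}" "4 * card X < n" by blast
    have "t * (n choose card X) \<le> 2 ^ t * (n choose card X)"
      by (rule mult_le_mono1) (simp add: less_imp_le)
    \<comment> \<open>The constant 12 enters here: \<open>card X < n / 4\<close> and
      \<open>t \<le> n / 12\<close> give \<open>3 * (card X + t) \<le> n\<close>.\<close>
    also have "\<dots> \<le> n choose (card X + t)"
      using X(2) n by (intro power2_times_binomial_le) simp
    also have "\<dots> \<le> N" by (rule max)
    finally have *: "real t * real (n choose card X) \<le> real N"
      by (simp flip: of_nat_mult)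
    have pos: "0 < n choose card X" using X(2) by simp
    have "real t * (1 - 4 * real t / real n) / real N \<le> real t / real N"
      using N by (intro divide_right_mono mult_left_le) auto
    also have "\<dots> \<le> 1 / real (n choose card X)"
      using * N pos by (simp add: field_simps)
    also have "\<dots> = w X"
    proof -
      \<comment> \<open>A singleton selection has nothing below its member, so its weight carries no
        correction.\<close>
      have "{Z \<in> U. Z \<subset> X} = {}" using below[OF i, of X] X(1) by auto
      then show ?thesis unfolding w_def by (simp only: card.empty of_nat_0 div_0 diff_zero)
    qed
    finally show ?thesis using X(1) by simp
  next
    assume "card (S i) = t \<and> (\<forall>X\<in>S i. n \<le> 4 * card X)"
    then have cS: "card (S i) = t" and big: "\<And>X. X \<in> S i \<Longrightarrow> n \<le> 4 * card X" by auto
    have "(1 - 4 * real t / real n) / real N \<le> w Y" if Y: "Y \<in> S i" for Y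
    proof -
      have "card {X \<in> U. X \<subset> Y} \<le> t"
        using card_mono[OF finS[OF i], of "{X \<in> S i. X \<subset> Y}"] below[OF i Y] cS by auto
      moreover have cY: "real n \<le> 4 * real (card Y)" using big[OF Y] by linarith
      moreover have n0: "0 < real n" using t n by simp
      ultimately have "real (card {X \<in> U. X \<subset> Y}) / real (card Y) \<le> real t / (real n / 4)"
        by (intro frac_le) auto
      then have 1: "1 - 4 * real t / real n
          \<le> 1 - real (card {X \<in> U. X \<subset> Y}) / real (card Y)"
        by (simp add: mult.commute)
      have "Y \<subseteq> {1..n}" using Y SC[OF i] C[OF i] by blast
      then have "card Y \<le> n" using card_mono[of "{1..n}" Y] by simp
      then have 2: "0 < n choose card Y" by simp
      \<comment> \<open>The sign matters: replacing the denominator \<open>N\<close> by the smaller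
        \<open>n choose card Y\<close> must not decrease the quotient.\<close>
      have 3: "0 \<le> 1 - 4 * real t / real n" using n n0 by (simp add: field_simps)
      show ?thesis unfolding w_def
        using 1 2 3 max[of "card Y"] by (intro frac_le) auto
    qed
    then have "(\<Sum>Y\<in>S i. (1 - 4 * real t / real n) / real N) \<le> (\<Sum>Y\<in>S i. w Y)"
      by (rule sum_mono)
    then show ?thesis by (simp add: cS)
  qed
  have "real m * (real t * (1 - 4 * real t / real n) / real N)
      = (\<Sum>i\<in>{1..m}. real t * (1 - 4 * real t / real n) / real N)" by simp
  also have "\<dots> \<le> (\<Sum>i\<in>{1..m}. \<Sum>Y\<in>S i. w Y)" by (rule sum_mono) (rule part)
  also have "\<dots> = (\<Sum>Y\<in>U. w Y)"
    unfolding U_def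
  proof (rule sum.UNION_disjoint[symmetric])
    show "\<forall>i\<in>{1..m}. \<forall>k\<in>{1..m}. i \<noteq> k \<longrightarrow> S i \<inter> S k = {}" using same by blast
  qed (use finS in auto)
  also have "\<dots> \<le> 1"
  proof -
    have "U \<subseteq> Pow {1..n}" unfolding U_def using SC C by blast
    from lym_with_subsets[OF _ this ne] show ?thesis by (simp add: w_def)
  qed
  finally show ?thesis using N by (simp add: field_simps N_def)
qed

section \<open>Asymptotic form of the packing bound\<close>

theorem theorem2:
  fixes P :: "'a set" and lt :: "'a \<Rightarrow> 'a \<Rightarrow> bool" and j :: nat
  assumes "finite_poset P lt" and "P \<noteq> {}" and "j \<in> {1, 2}"
  shows "\<exists>err :: nat \<Rightarrow> real. err \<in> O(\<lambda>n. 1 / real n) \<and>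
           (\<forall>\<^sub>F n in sequentially.
              real (M_num j P lt n)
                \<le> 1 / real (t_num j P lt) * real (n choose (n div 2)) * (1 + err n))"
proof -
  define t where "t = t_num j P lt"
  have t: "0 < t" unfolding t_def using assms by (intro t_num_pos)
  \<comment> \<open>The error term is \<open>2 * u\<close> with \<open>u = 4 * t / n\<close>,
    because 1 / (1 - u) is at most 1 + 2 u for u between 0 and 1/2.\<close>
  have "(\<lambda>n. 8 * real t / real n) \<in> O(\<lambda>n. 1 / real n)"
    by (rule bigoI[of _ "8 * real t"]) simp
  moreover have "\<forall>\<^sub>F n in sequentially.
      real (M_num j P lt n) \<le> 1 / real t * real (n choose (n div 2)) * (1 + 8 * real t / real n)"
    using eventually_ge_at_top[of "12 * t"]
  proof eventually_elim
    case (elim n)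
    define m where "m = M_num j P lt n"
    have "packable j P lt n m"
      using Max_in[OF finite_packable[OF assms(2)]] packable_0 unfolding m_def M_num_def by blast
    then obtain f where f: "\<And>i. i \<in> {1..m} \<Longrightarrow> embedding_kind j P lt n (f i)"
      and inc: "pairwise (\<lambda>i k. incomparable (f i ` P) (f k ` P)) {1..m}"
      unfolding packable_def by blast
    have "real m * (real t * (1 - 4 * real t / real n)) \<le> real (n choose (n div 2))"
    proof (rule packing_bound[OF t elim])
      show "conv n (f i ` P) \<subseteq> Pow {1..n}" for i by (auto simp: conv_def boolean_lattice_def)
      show "t \<le> card (conv n (f i ` P))" if "i \<in> {1..m}" for i
        unfolding t_def using f[OF that] by (rule t_num_le_card_conv)
      show "pairwise (\<lambda>i k. incomparable (conv n (f i ` P)) (conv n (f k ` P))) {1..m}"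
        using inc by (rule pairwise_mono) (auto intro: incomparable_conv)
    qed
    moreover define u where "u = 4 * real t / real n"
    ultimately have bound: "real m * (real t * (1 - u)) \<le> real (n choose (n div 2))" by simp
    have u: "0 \<le> u" "u \<le> 1 / 3" using t elim by (auto simp: u_def field_simps)
    \<comment> \<open>Twice this product is exactly the excess of
      \<open>(1 - u) * (1 + 2 * u)\<close> over 1.\<close>
    have "u * (1 / 2 - u) \<ge> 0" using u by (intro mult_nonneg_nonneg) auto
    then have "1 \<le> (1 - u) * (1 + 2 * u)" by (simp add: algebra_simps)
    then have "real m * real t * 1 \<le> real m * real t * ((1 - u) * (1 + 2 * u))"
      by (rule mult_left_mono) simp
    also have "\<dots> = real m * (real t * (1 - u)) * (1 + 2 * u)" by simp
    also have "\<dots> \<le> real (n choose (n div 2)) * (1 + 2 * u)"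
      using bound u by (intro mult_right_mono) auto
    finally have "real m \<le> 1 / real t * real (n choose (n div 2)) * (1 + 2 * u)"
      using t by (simp add: field_simps)
    then show ?case by (simp add: u_def m_def)
  qed
  ultimately show ?thesis unfolding t_def by blast
qed

end
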